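(* Let $M$ and $N$ be path-connected smooth manifolds and let $h\colon M\to N$ be a diffeomorphism. If $W\subset N$ is a submanifold of codimension $1$, then $$\mathrm{TTC}(N,W)=\mathrm{TTC}(M,h^{-1}(W)).$$
   Context: Smooth manifolds and submanifolds are without boundary. For a smooth manifold $X$, $X^{[0,1]}$ is the space of all continuous paths $[0,1]\to X$ with the compact-open topology, and $e_2^X\colon X^{[0,1]}\to X\times X$ is $e_2^X(\gamma)=(\gamma(0),\gamma(1))$. Semi-transversality: for a submanifold $Z\subset X$ of codimension $1$, a path $\Gamma\colon[0,1]\to X$ is semi-transversal to $Z$, written $\Gamma\pitchfork_s Z$, if whenever $t\in(0,1)$ and $\Gamma(t)\in Z$, then $\Gamma$ is smooth in $t$ and $\langle\Gamma'(t)\rangle+T_{\Gamma(t)}Z=T_{\Gamma(t)}X$ (equivalently, $\Gamma'(t)\notin T_{\Gamma(t)}Z$), where $\langle\Gamma'(t)\rangle$ is the subspace generated by $\Gamma'(t)$. No condition is imposed at $t=0,1$. Transversal topological complexity: for a path-connected smooth manifold $X$ and a submanifold $Z\subset X$ of codimension $1$, $\mathrm{TTC}(X,Z)$ is the smallest positive integer $k$ for which $X\times X$ is covered by $k$ open subsets $U_1,\ldots,U_k$ such that for each $i$ there exists a continuous map $s_i\colon U_i\to X^{[0,1]}$ with $e_2^X\circ s_i$ equal to the inclusion $U_i\hookrightarrow X\times X$ and $s_i(x,y)\pitchfork_s Z$ for every $(x,y)\in U_i$; if no such $k$ exists, $\mathrm{TTC}(X,Z)=\infty$. The preimage $h^{-1}(W)$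 is a codimension $1$ submanifold of $M$. *)

theory Defs
  imports "HOL-Analysis.Analysis" "HOL-Library.Extended_Nat"
begin

section \<open>Smooth maps between open subsets of Euclidean spaces\<close>

text \<open>For open \<open>S\<close> this says that all iterated directional derivatives of order at most \<open>n\<close> are
  continuous and those of order less than \<open>n\<close> are differentiable, i.e. that \<open>f\<close> is of class
  $C^n$ on \<open>S\<close>.\<close>

primrec times_differentiable_on ::
    "nat \<Rightarrow> 'e::euclidean_space set \<Rightarrow> ('e \<Rightarrow> 'f::euclidean_space) \<Rightarrow> bool" where
  "times_differentiable_on 0 S f \<longleftrightarrow> continuous_on S f"
| "times_differentiable_on (Suc n) S f \<longleftrightarrow>
     (\<forall>x\<in>S. f differentiable (at x)) \<and>
     (\<forall>v. times_differentiable_on n S (\<lambda>x. frechet_derivative f (at x) v))"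

definition smooth_on :: "'e::euclidean_space set \<Rightarrow> ('e \<Rightarrow> 'f::euclidean_space) \<Rightarrow> bool" where
  "smooth_on S f \<longleftrightarrow> open S \<and> (\<forall>n. times_differentiable_on n S f)"


section \<open>Smooth manifolds\<close>

text \<open>A chart is a pair of its domain and a coordinate map, whose values outside the domain are
  irrelevant. The dimension is \<open>DIM('e)\<close>, so it is positive; a manifold of dimension \<open>0\<close> has no
  submanifolds of codimension \<open>1\<close>.\<close>

type_synonym ('a, 'e) chart = "'a set \<times> ('a \<Rightarrow> 'e)"

definition is_chart :: "'a topology \<Rightarrow> ('a, 'e::euclidean_space) chart \<Rightarrow> bool" where
  "is_chart X = (\<lambda>(U, \<phi>). openin X U \<and> open (\<phi> ` U) \<and>
     homeomorphic_map (subtopology X U) (top_of_set (\<phi> ` U)) \<phi>)"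

definition compatible ::
    "('a, 'e::euclidean_space) chart \<Rightarrow> ('a, 'e) chart \<Rightarrow> bool" where
  "compatible = (\<lambda>(U, \<phi>) (V, \<psi>).
     smooth_on (\<phi> ` (U \<inter> V)) (\<psi> \<circ> inv_into U \<phi>) \<and>
     smooth_on (\<psi> ` (U \<inter> V)) (\<phi> \<circ> inv_into V \<psi>))"

text \<open>The smooth structure \<open>A\<close> is a maximal atlas.\<close>

definition smooth_manifold :: "'a topology \<Rightarrow> ('a, 'e::euclidean_space) chart set \<Rightarrow> bool" where
  "smooth_manifold X A \<longleftrightarrow>
     Hausdorff_space X \<and> second_countable X \<and>
     (\<forall>c\<in>A. is_chart X c) \<and>
     (\<Union>c\<in>A. fst c) = topspace X \<and>
     (\<forall>c\<in>A. \<forall>d\<in>A. compatible c d) \<and>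
     (\<forall>c. is_chart X c \<and> (\<forall>d\<in>A. compatible c d) \<longrightarrow> c \<in> A)"

definition smooth_map ::
    "'a topology \<Rightarrow> ('a, 'e::euclidean_space) chart set \<Rightarrow>
     'b topology \<Rightarrow> ('b, 'f::euclidean_space) chart set \<Rightarrow> ('a \<Rightarrow> 'b) \<Rightarrow> bool" where
  "smooth_map X A Y B h \<longleftrightarrow>
     continuous_map X Y h \<and>
     (\<forall>(U, \<phi>)\<in>A. \<forall>(V, \<psi>)\<in>B. smooth_on (\<phi> ` {x\<in>U. h x \<in> V}) (\<psi> \<circ> h \<circ> inv_into U \<phi>))"

definition diffeomorphism ::
    "'a topology \<Rightarrow> ('a, 'e::euclidean_space) chart set \<Rightarrow>
     'b topology \<Rightarrow> ('b, 'f::euclidean_space) chart set \<Rightarrow> ('a \<Rightarrow> 'b) \<Rightarrow> bool" where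
  "diffeomorphism X A Y B h \<longleftrightarrow>
     bij_betw h (topspace X) (topspace Y) \<and>
     smooth_map X A Y B h \<and> smooth_map Y B X A (inv_into (topspace X) h)"

text \<open>Embedded submanifolds of codimension \<open>k\<close>, described by slice charts.\<close>

definition submanifold ::
    "'a topology \<Rightarrow> ('a, 'e::euclidean_space) chart set \<Rightarrow> nat \<Rightarrow> 'a set \<Rightarrow> bool" where
  "submanifold X A k Z \<longleftrightarrow>
     Z \<subseteq> topspace X \<and>
     (\<forall>p\<in>Z. \<exists>(U, \<phi>)\<in>A. \<exists>H. p \<in> U \<and> subspace H \<and> dim H + k = DIM('e) \<and>
        \<phi> ` (U \<inter> Z) = \<phi> ` U \<inter> H)"


section \<open>Curves and tangent vectors\<close>

definition smooth_curve_on ::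
    "'a topology \<Rightarrow> ('a, 'e::euclidean_space) chart set \<Rightarrow> real set \<Rightarrow> (real \<Rightarrow> 'a) \<Rightarrow> bool" where
  "smooth_curve_on X A I c \<longleftrightarrow>
     open I \<and> continuous_map (top_of_set I) X c \<and>
     (\<forall>(U, \<phi>)\<in>A. smooth_on {s\<in>I. c s \<in> U} (\<phi> \<circ> c))"

definition smooth_curve_at ::
    "'a topology \<Rightarrow> ('a, 'e::euclidean_space) chart set \<Rightarrow> (real \<Rightarrow> 'a) \<Rightarrow> real \<Rightarrow> bool" where
  "smooth_curve_at X A c t \<longleftrightarrow> (\<exists>I. t \<in> I \<and> smooth_curve_on X A I c)"

definition smooth_functions :: "('a, 'e::euclidean_space) chart set \<Rightarrow> ('a \<Rightarrow> real) set" where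
  "smooth_functions A = {f. \<forall>(U, \<phi>)\<in>A. smooth_on (\<phi> ` U) (f \<circ> inv_into U \<phi>)}"

text \<open>Tangent vectors are directional derivatives, i.e. functionals on the smooth functions; the
  value \<open>0\<close> elsewhere makes equality of functionals the equality of tangent vectors, and vector
  space operations are pointwise. The velocity of \<open>c\<close> at \<open>t\<close> is meant for \<open>c\<close> smooth at \<open>t\<close>.\<close>

definition velocity ::
    "('a, 'e::euclidean_space) chart set \<Rightarrow> (real \<Rightarrow> 'a) \<Rightarrow> real \<Rightarrow> (('a \<Rightarrow> real) \<Rightarrow> real)" where
  "velocity A c t = (\<lambda>f. if f \<in> smooth_functions A then deriv (f \<circ> c) t else 0)"

text \<open>The velocities at \<open>p\<close> of the smooth curves of \<open>X\<close> that run inside \<open>S\<close>. For \<open>S = topspace X\<close>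
  this is the tangent space of \<open>X\<close> at \<open>p\<close>, and for a submanifold \<open>S\<close> it is the tangent space of \<open>S\<close>
  at \<open>p\<close>, as a subspace of that of \<open>X\<close>.\<close>

definition tangent_space ::
    "'a topology \<Rightarrow> ('a, 'e::euclidean_space) chart set \<Rightarrow> 'a set \<Rightarrow> 'a \<Rightarrow>
     (('a \<Rightarrow> real) \<Rightarrow> real) set" where
  "tangent_space X A S p =
     {velocity A c 0 | c. \<exists>I. 0 \<in> I \<and> smooth_curve_on X A I c \<and> c ` I \<subseteq> S \<and> c 0 = p}"


section \<open>Semi-transversality and transversal topological complexity\<close>

definition semi_transversal ::
    "'a topology \<Rightarrow> ('a, 'e::euclidean_space) chart set \<Rightarrow> 'a set \<Rightarrow> (real \<Rightarrow> 'a) \<Rightarrow> bool" where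
  "semi_transversal X A Z \<Gamma> \<longleftrightarrow>
     (\<forall>t\<in>{0<..<1}. \<Gamma> t \<in> Z \<longrightarrow>
        smooth_curve_at X A \<Gamma> t \<and>
        {\<lambda>f. a * velocity A \<Gamma> t f + w f | a w. w \<in> tangent_space X A Z (\<Gamma> t)}
          = tangent_space X A (topspace X) (\<Gamma> t))"

text \<open>Paths are made extensional, so that each path has a unique representative as a function on
  the reals. The topology is the compact-open one.\<close>

definition paths :: "'a topology \<Rightarrow> (real \<Rightarrow> 'a) set" where
  "paths X = {\<gamma> \<in> extensional {0..1}. pathin X \<gamma>}"

definition path_space :: "'a topology \<Rightarrow> (real \<Rightarrow> 'a) topology" where
  "path_space X = topology_generated_by
     {{\<gamma> \<in> paths X. \<gamma> ` K \<subseteq> O'} | K O'. compact K \<and> K \<subseteq> {0..1} \<and> openin X O'}"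

lemma topspace_path_space: "topspace (path_space X) = paths X"
proof -
  have "paths X = {\<gamma> \<in> paths X. \<gamma> ` {} \<subseteq> {}}" "compact ({}::real set)" "openin X {}"
    by auto
  then show ?thesis
    unfolding path_space_def topology_generated_by_topspace by blast
qed

definition endpoints :: "(real \<Rightarrow> 'a) \<Rightarrow> 'a \<times> 'a" where
  "endpoints \<gamma> = (\<gamma> 0, \<gamma> 1)"

definition has_transversal_cover ::
    "'a topology \<Rightarrow> ('a, 'e::euclidean_space) chart set \<Rightarrow> 'a set \<Rightarrow> nat \<Rightarrow> bool" where
  "has_transversal_cover X A Z k \<longleftrightarrow>
     (\<exists>U :: nat \<Rightarrow> ('a \<times> 'a) set.
        (\<forall>i\<in>{1..k}. openin (prod_topology X X) (U i)) \<and>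
        (\<Union>i\<in>{1..k}. U i) = topspace X \<times> topspace X \<and>
        (\<forall>i\<in>{1..k}. \<exists>s.
           continuous_map (subtopology (prod_topology X X) (U i)) (path_space X) s \<and>
           (\<forall>q\<in>U i. endpoints (s q) = q \<and> semi_transversal X A Z (s q))))"

text \<open>The infimum of the empty set of extended naturals is \<open>\<infinity>\<close>.\<close>

definition TTC ::
    "'a topology \<Rightarrow> ('a, 'e::euclidean_space) chart set \<Rightarrow> 'a set \<Rightarrow> enat" where
  "TTC X A Z = Inf {enat k | k. k \<ge> 1 \<and> has_transversal_cover X A Z k}"

end

theory Submission
  imports Defs
begin

text \<open>A diffeomorphism \<open>h\<close> carries a path \<open>\<gamma>\<close> to \<open>h \<circ> \<gamma>\<close>, continuously for the compact-open
  topologies, and its differential is a linear bijection of tangent spaces that takes the velocity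
  of \<open>\<gamma>\<close> to that of \<open>h \<circ> \<gamma>\<close>. Hence it takes semi-transversal paths to semi-transversal paths, and
  conjugating local sections with \<open>h \<times> h\<close> gives local sections on the other side. As \<open>h\<close> and its
  inverse play the same role, the two complexities bound each other.\<close>

section \<open>Calculus of smooth maps between open sets\<close>

text \<open>A derivative at \<open>x\<close> depends only on values near \<open>x\<close>, and an
  open \<open>S\<close> contains such a neighbourhood; so agreement on \<open>S\<close> passes to
  the derivatives and the induction goes on. This makes the values of charts and their inverses
  outside their domains harmless.\<close>

lemma times_differentiable_on_cong:
  assumes "open S" "\<And>x. x \<in> S \<Longrightarrow> f x = g x" "times_differentiable_on n S f"
  shows "times_differentiable_on n S g"
  using assms(2,3)
proof (induction n arbitrary: f g)
  case 0
  then show ?case by (simp cong: continuous_on_cong)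
next
  case (Suc n)
  have der: "(g has_derivative frechet_derivative f (at x)) (at x)" if "x \<in> S" for x
  proof (rule has_derivative_transform_within_open[OF _ \<open>open S\<close> that])
    show "(f has_derivative frechet_derivative f (at x)) (at x)"
      using Suc.prems that by (auto simp: frechet_derivative_works[symmetric])
  qed (use Suc.prems in auto)
  then have eq: "frechet_derivative f (at x) = frechet_derivative g (at x)" if "x \<in> S" for x
    using frechet_derivative_at that by blast
  have "times_differentiable_on n S (\<lambda>x. frechet_derivative g (at x) v)" for v
    by (rule Suc.IH[of "\<lambda>x. frechet_derivative f (at x) v"]) (use eq Suc.prems in auto)
  then show ?case
    using der by (auto simp: differentiable_def)
qed

lemma times_differentiable_on_subset:
  "times_differentiable_on n S f \<Longrightarrow> T \<subseteq> S \<Longrightarrow> times_differentiable_on n T f"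
  by (induction n arbitrary: f) (auto intro: continuous_on_subset)

text \<open>The successor clause does not mention lower orders, so lowering the order takes an
  induction, which ends in differentiable implies continuous.\<close>

lemma times_differentiable_on_Suc_imp:
  "times_differentiable_on (Suc n) S f \<Longrightarrow> times_differentiable_on n S f"
proof (induction n arbitrary: f)
  case 0
  then show ?case
    by (auto intro!: differentiable_imp_continuous_on differentiable_at_imp_differentiable_on)
next
  case (Suc n)
  have "times_differentiable_on n S (\<lambda>x. frechet_derivative f (at x) v)" for v
    using Suc.prems by (intro Suc.IH) simp
  then show ?case
    using Suc.prems by simp
qed

text \<open>Every clause concerns single points or is continuity, which on open neighbourhoods is
  pointwise too. This is what permits working in one chart at a time.\<close>

lemma times_differentiable_on_locally:
  assumes "\<And>x. x \<in> S \<Longrightarrow> \<exists>T. open T \<and> x \<in> T \<and> times_differentiable_on n T f"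
  shows "times_differentiable_on n S f"
  using assms
proof (induction n arbitrary: f)
  case 0
  then show ?case
    by (metis continuous_at_imp_continuous_on continuous_on_eq_continuous_at
        times_differentiable_on.simps(1))
next
  case (Suc n)
  have "times_differentiable_on n S (\<lambda>x. frechet_derivative f (at x) v)" for v
    by (rule Suc.IH) (use Suc.prems in \<open>fastforce simp: times_differentiable_on.simps\<close>)
  then show ?case
    using Suc.prems by fastforce
qed

section \<open>Sums, products and composites of maps of class C^n\<close>

lemma times_differentiable_on_const:
  "times_differentiable_on n S (\<lambda>x. c)"
  by (induction n arbitrary: c) (auto simp: frechet_derivative_const)

lemma times_differentiable_on_add:
  assumes "open S" "times_differentiable_on n S f" "times_differentiable_on n S g"
  shows "times_differentiable_on n S (\<lambda>x. f x + g x)"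
  using assms(2,3)
proof (induction n arbitrary: f g)
  case 0
  then show ?case by (auto intro!: continuous_intros)
next
  case (Suc n)
  have "times_differentiable_on n S (\<lambda>x. frechet_derivative (\<lambda>x. f x + g x) (at x) v)" for v
  proof (rule times_differentiable_on_cong[OF \<open>open S\<close>])
    show "times_differentiable_on n S
        (\<lambda>x. frechet_derivative f (at x) v + frechet_derivative g (at x) v)"
      using Suc by simp
    show "frechet_derivative f (at x) v + frechet_derivative g (at x) v
        = frechet_derivative (\<lambda>x. f x + g x) (at x) v" if "x \<in> S" for x
    proof -
      have "((\<lambda>x. f x + g x) has_derivative
          (\<lambda>v. frechet_derivative f (at x) v + frechet_derivative g (at x) v)) (at x)"
        using Suc.prems that
        by (intro has_derivative_add) (auto simp: frechet_derivative_works[symmetric])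
      from frechet_derivative_at[OF this] show ?thesis by metis
    qed
  qed
  then show ?case using Suc.prems by auto
qed

lemma times_differentiable_on_sum:
  assumes "open S" "finite J" "\<And>j. j \<in> J \<Longrightarrow> times_differentiable_on n S (f j)"
  shows "times_differentiable_on n S (\<lambda>x. \<Sum>j\<in>J. f j x)"
  using assms(2,3)
  by (induction J rule: finite_induct)
    (auto intro: times_differentiable_on_const times_differentiable_on_add[OF \<open>open S\<close>])

lemma times_differentiable_on_inner_const:
  assumes "open S" "times_differentiable_on n S f"
  shows "times_differentiable_on n S (\<lambda>x. f x \<bullet> b)"
  using assms(2)
proof (induction n arbitrary: f)
  case 0
  then show ?case by (auto intro!: continuous_intros)
next
  case (Suc n)
  have der: "((\<lambda>x. f x \<bullet> b) has_derivative (\<lambda>v. frechet_derivative f (at x) v \<bullet> b)) (at x)"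
    if "x \<in> S" for x
    using Suc.prems that
    by (intro has_derivative_inner_left) (auto simp: frechet_derivative_works[symmetric])
  have "times_differentiable_on n S (\<lambda>x. frechet_derivative (\<lambda>x. f x \<bullet> b) (at x) v)" for v
  proof (rule times_differentiable_on_cong[OF \<open>open S\<close>])
    show "times_differentiable_on n S (\<lambda>x. frechet_derivative f (at x) v \<bullet> b)"
      using Suc by simp
    show "frechet_derivative f (at x) v \<bullet> b = frechet_derivative (\<lambda>x. f x \<bullet> b) (at x) v"
      if "x \<in> S" for x
      using frechet_derivative_at[OF der[OF that]] by metis
  qed
  then show ?case using der by (auto simp: differentiable_def)
qed

lemma times_differentiable_on_scaleR:
  assumes "open S" "times_differentiable_on n S f" "times_differentiable_on n S g"
  shows "times_differentiable_on n S (\<lambda>x. f x *\<^sub>R g x)"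
  using assms(2,3)
proof (induction n arbitrary: f g)
  case 0
  then show ?case by (auto intro!: continuous_intros)
next
  case (Suc n)
  have der: "((\<lambda>x. f x *\<^sub>R g x) has_derivative
      (\<lambda>v. f x *\<^sub>R frechet_derivative g (at x) v + frechet_derivative f (at x) v *\<^sub>R g x)) (at x)"
    if "x \<in> S" for x
    using Suc.prems that
    by (intro has_derivative_scaleR) (auto simp: frechet_derivative_works[symmetric])
  have "times_differentiable_on n S (\<lambda>x. frechet_derivative (\<lambda>x. f x *\<^sub>R g x) (at x) v)" for v
  proof (rule times_differentiable_on_cong[OF \<open>open S\<close>])
    \<comment> \<open>The product rule keeps an undifferentiated factor in each summand, so
      \<open>f\<close> and \<open>g\<close> themselves are needed at order \<open>n\<close>.\<close>
    have "times_differentiable_on n S f" "times_differentiable_on n S g"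
      using Suc.prems times_differentiable_on_Suc_imp by blast+
    then show "times_differentiable_on n S
        (\<lambda>x. f x *\<^sub>R frechet_derivative g (at x) v + frechet_derivative f (at x) v *\<^sub>R g x)"
      using Suc by (intro times_differentiable_on_add[OF \<open>open S\<close>]) auto
    show "f x *\<^sub>R frechet_derivative g (at x) v + frechet_derivative f (at x) v *\<^sub>R g x
        = frechet_derivative (\<lambda>x. f x *\<^sub>R g x) (at x) v" if "x \<in> S" for x
      using frechet_derivative_at[OF der[OF that]] by metis
  qed
  then show ?case using der by (auto simp: differentiable_def)
qed

text \<open>In the chain rule the derivative of \<open>g\<close> is taken in a direction that varies
  with \<open>x\<close>, while the definition controls only fixed directions. Expanding that
  direction in \<open>Basis\<close> gives a sum of products of coordinates of the derivative of
  \<open>f\<close> with partial derivatives of \<open>g\<close> composed with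
  \<open>f\<close>.\<close>

lemma times_differentiable_on_compose:
  assumes "open S" "f ` S \<subseteq> T"
    and "times_differentiable_on n S f" "times_differentiable_on n T g"
  shows "times_differentiable_on n S (g \<circ> f)"
  using assms(3,4)
proof (induction n arbitrary: g)
  case 0
  then show ?case
    using continuous_on_compose[of S f g] continuous_on_subset[OF _ assms(2), of g] by simp
next
  case (Suc n)
  have derf: "(f has_derivative frechet_derivative f (at x)) (at x)"
    and derg: "(g has_derivative frechet_derivative g (at (f x))) (at (f x))" if "x \<in> S" for x
    using Suc.prems that assms(2)
    by (simp_all add: frechet_derivative_works[symmetric] image_subset_iff)
  have der: "(g \<circ> f has_derivative
      frechet_derivative g (at (f x)) \<circ> frechet_derivative f (at x)) (at x)" if "x \<in> S" for x
    using that by (intro diff_chain_at derf derg)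
  have "times_differentiable_on n S (\<lambda>x. frechet_derivative (g \<circ> f) (at x) v)" for v
  proof (rule times_differentiable_on_cong[OF \<open>open S\<close>])
    have f: "times_differentiable_on n S f"
      using Suc.prems times_differentiable_on_Suc_imp by blast
    have "times_differentiable_on n S (\<lambda>x. frechet_derivative f (at x) v \<bullet> b)" for b
      using Suc.prems by (intro times_differentiable_on_inner_const[OF \<open>open S\<close>]) simp
    \<comment> \<open>The induction hypothesis is used for a partial derivative of \<open>g\<close>
      with the same \<open>f\<close>, which is why only \<open>g\<close> is generalized.\<close>
    moreover have
      "times_differentiable_on n S ((\<lambda>y. frechet_derivative g (at y) b) \<circ> f)" for b
      using Suc.prems f by (intro Suc.IH) auto
    ultimately show "times_differentiable_on n S (\<lambda>x. \<Sum>b\<in>Basis.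
        (frechet_derivative f (at x) v \<bullet> b) *\<^sub>R ((\<lambda>y. frechet_derivative g (at y) b) \<circ> f) x)"
      by (intro times_differentiable_on_sum times_differentiable_on_scaleR \<open>open S\<close> finite_Basis)
    show "(\<Sum>b\<in>Basis. (frechet_derivative f (at x) v \<bullet> b) *\<^sub>R
          ((\<lambda>y. frechet_derivative g (at y) b) \<circ> f) x)
        = frechet_derivative (g \<circ> f) (at x) v" if "x \<in> S" for x
    proof -
      let ?g' = "frechet_derivative g (at (f x))" and ?v = "frechet_derivative f (at x) v"
      have lin: "linear ?g'"
        using derg[OF that] by (rule has_derivative_linear)
      have "(\<Sum>b\<in>Basis. (?v \<bullet> b) *\<^sub>R ?g' b) = ?g' (\<Sum>b\<in>Basis. (?v \<bullet> b) *\<^sub>R b)"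
        by (simp only: linear_sum[OF lin] linear_cmul[OF lin])
      also have "\<dots> = (?g' \<circ> frechet_derivative f (at x)) v"
        by (simp only: euclidean_representation comp_apply)
      also have "\<dots> = frechet_derivative (g \<circ> f) (at x) v"
        by (simp only: frechet_derivative_at[OF der[OF that]])
      finally show ?thesis
        by (simp only: comp_apply)
    qed
  qed
  then show ?case
    unfolding times_differentiable_on.simps by (intro conjI ballI allI differentiableI[OF der])
qed

lemma smooth_on_compose:
  assumes "smooth_on S f" "smooth_on T g" "f ` S \<subseteq> T"
  shows "smooth_on S (g \<circ> f)"
  using assms times_differentiable_on_compose unfolding smooth_on_def by blast

lemma smooth_on_cong:
  assumes "smooth_on S f" "\<And>x. x \<in> S \<Longrightarrow> f x = g x"
  shows "smooth_on S g"
  using assms times_differentiable_on_cong unfolding smooth_on_def by blast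

lemma smooth_on_subset:
  assumes "smooth_on S f" "open T" "T \<subseteq> S"
  shows "smooth_on T f"
  using assms times_differentiable_on_subset unfolding smooth_on_def by blast

lemma smooth_on_locally:
  assumes "\<And>x. x \<in> S \<Longrightarrow> \<exists>T. x \<in> T \<and> T \<subseteq> S \<and> smooth_on T f"
  shows "smooth_on S f"
proof -
  \<comment> \<open>\<open>smooth_on\<close> includes openness, here inherited from the open
    neighbourhoods \<open>T\<close> inside \<open>S\<close>.\<close>
  have "open S"
    using assms unfolding smooth_on_def by (metis openI open_contains_ball subset_trans)
  then show ?thesis
    using assms times_differentiable_on_locally[of S _ f] unfolding smooth_on_def by metis
qed


section \<open>Curves\<close>

lemma smooth_curve_on_subset:
  assumes "smooth_curve_on X A I c" "open J" "J \<subseteq> I"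
  shows "smooth_curve_on X A J c"
proof -
  have "smooth_on {s \<in> J. c s \<in> U} (\<phi> \<circ> c)" if "(U, \<phi>) \<in> A" for U \<phi>
  proof -
    have s: "smooth_on {s \<in> I. c s \<in> U} (\<phi> \<circ> c)"
      using assms(1) that by (auto simp: smooth_curve_on_def)
    have eq: "{s \<in> J. c s \<in> U} = {s \<in> I. c s \<in> U} \<inter> J"
      using assms(3) by auto
    have "open {s \<in> J. c s \<in> U}"
      unfolding eq using s assms(2) by (auto simp: smooth_on_def)
    then show ?thesis
      using smooth_on_subset[OF s] assms(3) by blast
  qed
  moreover have "continuous_map (top_of_set J) X c"
    using assms by (auto simp: smooth_curve_on_def intro: continuous_map_from_subtopology_mono)
  ultimately show ?thesis
    using assms(2) by (auto simp: smooth_curve_on_def)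
qed

lemma smooth_curve_on_cong:
  assumes "smooth_curve_on X A I c" "\<And>s. s \<in> I \<Longrightarrow> c s = d s"
  shows "smooth_curve_on X A I d"
proof -
  have "smooth_on {s \<in> I. d s \<in> U} (\<phi> \<circ> d)" if "(U, \<phi>) \<in> A" for U \<phi>
  proof -
    have "smooth_on {s \<in> I. c s \<in> U} (\<phi> \<circ> c)"
      using assms(1) that by (auto simp: smooth_curve_on_def)
    moreover have "{s \<in> I. c s \<in> U} = {s \<in> I. d s \<in> U}"
      using assms(2) by auto
    ultimately show ?thesis
      using assms(2) by (auto intro: smooth_on_cong)
  qed
  moreover have "continuous_map (top_of_set I) X d"
    using assms by (auto simp: smooth_curve_on_def intro: continuous_map_eq)
  ultimately show ?thesis
    using assms(1) by (auto simp: smooth_curve_on_def)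
qed

text \<open>\<open>deriv\<close> sees only the germ at \<open>t\<close>. This lets a path be
  replaced by its extensional restriction, and a curve by its image under a map and back.\<close>

lemma velocity_cong:
  assumes "open I" "t \<in> I" "\<And>s. s \<in> I \<Longrightarrow> c s = d s"
  shows "velocity A c t = velocity A d t"
proof -
  have "\<forall>\<^sub>F s in nhds t. (f \<circ> c) s = (f \<circ> d) s" for f :: "'a \<Rightarrow> real"
    using assms by (auto simp: eventually_nhds)
  then show ?thesis
    unfolding velocity_def by (auto simp: fun_eq_iff intro: deriv_cong_ev)
qed


section \<open>Transport along a diffeomorphism\<close>

text \<open>The differential of \<open>h\<close> on functionals. The default \<open>0\<close>
  matches the one in \<open>velocity\<close>, so that velocities go to velocities as equal functions
  and not just on smooth arguments.\<close>

definition pushforward ::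
    "('b, 'f::euclidean_space) chart set \<Rightarrow> ('a \<Rightarrow> 'b) \<Rightarrow>
     (('a \<Rightarrow> real) \<Rightarrow> real) \<Rightarrow> (('b \<Rightarrow> real) \<Rightarrow> real)" where
  "pushforward B h w = (\<lambda>f. if f \<in> smooth_functions B then w (f \<circ> h) else 0)"

text \<open>Injectivity lets \<open>inv_into U \<phi>\<close> cancel \<open>\<phi>\<close> on
  \<open>U\<close> in all coordinate computations.\<close>

lemma chart_open_inj:
  assumes "smooth_manifold X A" "(U, \<phi>) \<in> A"
  shows "openin X U" "inj_on \<phi> U" "open (\<phi> ` U)"
proof -
  have c: "is_chart X (U, \<phi>)"
    using assms by (auto simp: smooth_manifold_def)
  then show "openin X U" "open (\<phi> ` U)"
    by (auto simp: is_chart_def)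
  then have "topspace (subtopology X U) = U"
    using openin_subset by auto
  then show "inj_on \<phi> U"
    using c by (auto simp: is_chart_def homeomorphic_map_def injective_quotient_map
        homeomorphic_eq_everything_map)
qed

lemma chart_around:
  assumes "smooth_manifold X A" "p \<in> topspace X"
  obtains U \<phi> where "(U, \<phi>) \<in> A" "p \<in> U"
proof -
  have "p \<in> (\<Union>c\<in>A. fst c)"
    using assms by (simp add: smooth_manifold_def)
  then show ?thesis
    using that by auto
qed

text \<open>Collects what follows from smoothness in one direction, so that it applies to a
  diffeomorphism and to its inverse alike.\<close>

locale smooth_map_between =
  fixes X :: "'a topology" and A :: "('a, 'e::euclidean_space) chart set"
    and Y :: "'b topology" and B :: "('b, 'f::euclidean_space) chart set"
    and h :: "'a \<Rightarrow> 'b"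
  assumes X: "smooth_manifold X A" and Y: "smooth_manifold Y B" and h: "smooth_map X A Y B h"
begin

lemma h_continuous: "continuous_map X Y h"
  using h by (simp add: smooth_map_def)

lemma h_in: "x \<in> topspace X \<Longrightarrow> h x \<in> topspace Y"
  using h_continuous by (auto simp: continuous_map_def)

lemma h_charts:
  assumes "(U, \<phi>) \<in> A" "(V, \<psi>) \<in> B"
  shows "smooth_on (\<phi> ` {x \<in> U. h x \<in> V}) (\<psi> \<circ> h \<circ> inv_into U \<phi>)"
  using h assms by (auto simp: smooth_map_def)

text \<open>Near a point, insert a chart \<open>\<psi>\<close> around its image: the coordinate form
  of \<open>f \<circ> h\<close> is that of \<open>f\<close> after that of \<open>h\<close>. The
  cancellation of \<open>\<psi>\<close> is valid where \<open>h x \<in> V\<close>, hence the local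
  argument.\<close>

lemma smooth_function_compose:
  assumes f: "f \<in> smooth_functions B"
  shows "f \<circ> h \<in> smooth_functions A"
proof -
  have "smooth_on (\<phi> ` U) (f \<circ> h \<circ> inv_into U \<phi>)" if U: "(U, \<phi>) \<in> A" for U \<phi>
  proof (rule smooth_on_locally)
    note cU = chart_open_inj[OF X U]
    fix y assume "y \<in> \<phi> ` U"
    then obtain p where p: "p \<in> U" "y = \<phi> p" by auto
    then have "h p \<in> topspace Y"
      using cU openin_subset h_in by blast
    then obtain V \<psi> where V: "(V, \<psi>) \<in> B" "h p \<in> V"
      using chart_around[OF Y] by blast
    have "smooth_on (\<psi> ` V) (f \<circ> inv_into V \<psi>)"
      using f V by (auto simp: smooth_functions_def)
    moreover have "(\<psi> \<circ> h \<circ> inv_into U \<phi>) ` (\<phi> ` {x \<in> U. h x \<in> V}) \<subseteq> \<psi> ` V"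
      using cU by auto
    ultimately have
      "smooth_on (\<phi> ` {x \<in> U. h x \<in> V}) ((f \<circ> inv_into V \<psi>) \<circ> (\<psi> \<circ> h \<circ> inv_into U \<phi>))"
      using smooth_on_compose h_charts[OF U V(1)] by blast
    then have "smooth_on (\<phi> ` {x \<in> U. h x \<in> V}) (f \<circ> h \<circ> inv_into U \<phi>)"
      by (rule smooth_on_cong) (use cU chart_open_inj[OF Y V(1)] in auto)
    then show "\<exists>T. y \<in> T \<and> T \<subseteq> \<phi> ` U \<and> smooth_on T (f \<circ> h \<circ> inv_into U \<phi>)"
      using p V by (intro exI[of _ "\<phi> ` {x \<in> U. h x \<in> V}"]) auto
  qed
  then show ?thesis
    by (auto simp: smooth_functions_def)
qed

lemma smooth_curve_on_compose:
  assumes c: "smooth_curve_on X A I c"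
  shows "smooth_curve_on Y B I (h \<circ> c)"
proof -
  have I: "open I" and cc: "continuous_map (top_of_set I) X c"
    using c by (auto simp: smooth_curve_on_def)
  have hc: "continuous_map (top_of_set I) Y (h \<circ> c)"
    using cc h_continuous by (rule continuous_map_compose)
  have "smooth_on {s \<in> I. (h \<circ> c) s \<in> V} (\<psi> \<circ> (h \<circ> c))" if V: "(V, \<psi>) \<in> B" for V \<psi>
  proof (rule smooth_on_locally)
    fix s assume s: "s \<in> {s \<in> I. (h \<circ> c) s \<in> V}"
    have "openin (top_of_set I) {s \<in> topspace (top_of_set I). (h \<circ> c) s \<in> V}"
      using hc chart_open_inj[OF Y V] by (intro openin_continuous_map_preimage)
    then have oV: "open {s \<in> I. (h \<circ> c) s \<in> V}"
      using I by (simp add: openin_open_eq)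
    have "c s \<in> topspace X"
      using cc s by (auto simp: continuous_map_def)
    then obtain U \<phi> where U: "(U, \<phi>) \<in> A" "c s \<in> U"
      using chart_around[OF X] by blast
    note cU = chart_open_inj[OF X U(1)]
    \<comment> \<open>On \<open>J\<close> both charts are available, and there
      \<open>\<psi> \<circ> h \<circ> c\<close> factors through the coordinate form of
      \<open>h\<close>.\<close>
    define J where "J = {s \<in> I. c s \<in> U} \<inter> {s \<in> I. (h \<circ> c) s \<in> V}"
    have sc: "smooth_on {s \<in> I. c s \<in> U} (\<phi> \<circ> c)"
      using c U by (auto simp: smooth_curve_on_def)
    then have "smooth_on J (\<phi> \<circ> c)"
      by (rule smooth_on_subset) (use sc oV in \<open>auto simp: J_def smooth_on_def\<close>)
    moreover have "(\<phi> \<circ> c) ` J \<subseteq> \<phi> ` {x \<in> U. h x \<in> V}"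
      by (auto simp: J_def)
    ultimately have "smooth_on J ((\<psi> \<circ> h \<circ> inv_into U \<phi>) \<circ> (\<phi> \<circ> c))"
      using smooth_on_compose h_charts[OF U(1) V] by blast
    then have "smooth_on J (\<psi> \<circ> (h \<circ> c))"
      by (rule smooth_on_cong) (use cU in \<open>auto simp: J_def\<close>)
    then show "\<exists>T. s \<in> T \<and> T \<subseteq> {s \<in> I. (h \<circ> c) s \<in> V} \<and> smooth_on T (\<psi> \<circ> (h \<circ> c))"
      using s U by (intro exI[of _ J]) (auto simp: J_def)
  qed
  then show ?thesis
    using I hc by (auto simp: smooth_curve_on_def)
qed

text \<open>The chain rule is here just associativity of composition; smoothness of
  \<open>f \<circ> h\<close> keeps the inner velocity off its default value.\<close>

lemma velocity_compose: "velocity B (h \<circ> c) t = pushforward B h (velocity A c t)"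
  using smooth_function_compose
  by (auto simp: velocity_def pushforward_def fun_eq_iff comp_assoc)

section \<open>The induced map of path spaces\<close>

lemma paths_compose:
  assumes "\<gamma> \<in> paths X"
  shows "restrict (h \<circ> \<gamma>) {0..1} \<in> paths Y"
proof -
  have "continuous_map (top_of_set {0..1}) Y (h \<circ> \<gamma>)"
    using assms h_continuous by (auto simp: paths_def pathin_def intro: continuous_map_compose)
  then have "continuous_map (top_of_set {0..1}) Y (restrict (h \<circ> \<gamma>) {0..1})"
    by (rule continuous_map_eq) auto
  then show ?thesis
    by (auto simp: paths_def pathin_def)
qed

lemma path_in_topspace: "\<gamma> \<in> paths X \<Longrightarrow> t \<in> {0..1} \<Longrightarrow> \<gamma> t \<in> topspace X"
  by (auto simp: paths_def pathin_def continuous_map_def)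

text \<open>The preimage of the subbasic set given by \<open>K\<close> and \<open>O'\<close> is the
  one given by \<open>K\<close> and the preimage of \<open>O'\<close> under \<open>h\<close>;
  restricting to \<open>{0..1}\<close> changes nothing on \<open>K\<close>.\<close>

lemma path_space_compose:
  "continuous_map (path_space X) (path_space Y) (\<lambda>\<gamma>. restrict (h \<circ> \<gamma>) {0..1})"
  unfolding path_space_def[of Y]
proof (rule continuous_on_generated_topo)
  fix S assume "S \<in> {{\<gamma> \<in> paths Y. \<gamma> ` K \<subseteq> O'} |K O'. compact K \<and> K \<subseteq> {0..1} \<and> openin Y O'}"
  then obtain K O' where K: "compact K" "K \<subseteq> {0..1}" "openin Y O'"
    and S: "S = {\<gamma> \<in> paths Y. \<gamma> ` K \<subseteq> O'}"
    by auto
  have "(\<lambda>\<gamma>. restrict (h \<circ> \<gamma>) {0..1}) -` S \<inter> topspace (path_space X)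
      = {\<gamma> \<in> paths X. \<gamma> ` K \<subseteq> {x \<in> topspace X. h x \<in> O'}}"
    using K path_in_topspace
    by (auto simp: S topspace_path_space paths_compose image_subset_iff)
  moreover have "openin X {x \<in> topspace X. h x \<in> O'}"
    using h_continuous K by (intro openin_continuous_map_preimage)
  ultimately show
    "openin (path_space X) ((\<lambda>\<gamma>. restrict (h \<circ> \<gamma>) {0..1}) -` S \<inter> topspace (path_space X))"
    unfolding path_space_def[of X] using K by (auto intro!: topology_generated_by_Basis)
next
  \<comment> \<open>Continuity into a generated topology also asks that images lie in the union of
    the generators, which is \<open>paths Y\<close>.\<close>
  show "(\<lambda>\<gamma>. restrict (h \<circ> \<gamma>) {0..1}) ` topspace (path_space X)
      \<subseteq> \<Union> {{\<gamma> \<in> paths Y. \<gamma> ` K \<subseteq> O'} |K O'. compact K \<and> K \<subseteq> {0..1} \<and> openin Y O'}"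
    using topspace_path_space[of Y] paths_compose
    unfolding path_space_def[of Y] topology_generated_by_topspace
    by (auto simp: topspace_path_space)
qed

end

section \<open>Tangent spaces, semi-transversality and covers under mutually inverse smooth
  maps\<close>

locale inverse_smooth_maps = smooth_map_between X A Y B h
  for X :: "'a topology" and A :: "('a, 'e::euclidean_space) chart set"
    and Y :: "'b topology" and B :: "('b, 'f::euclidean_space) chart set"
    and h :: "'a \<Rightarrow> 'b" +
  fixes g :: "'b \<Rightarrow> 'a"
  assumes g: "smooth_map Y B X A g"
    and g_h: "\<And>x. x \<in> topspace X \<Longrightarrow> g (h x) = x"
    and h_g: "\<And>y. y \<in> topspace Y \<Longrightarrow> h (g y) = y"
begin

sublocale inv: smooth_map_between Y B X A g
  by unfold_locales (rule X Y g)+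

lemma tangent_space_image:
  assumes "S \<subseteq> topspace X" "p \<in> topspace X"
  shows "tangent_space Y B (h ` S) (h p) = pushforward B h ` tangent_space X A S p"
proof (intro equalityI subsetI)
  fix v assume "v \<in> tangent_space Y B (h ` S) (h p)"
  then obtain d I where d: "v = velocity B d 0" "0 \<in> I" "smooth_curve_on Y B I d"
    "d ` I \<subseteq> h ` S" "d 0 = h p"
    by (auto simp: tangent_space_def)
  have "open I"
    using d by (auto simp: smooth_curve_on_def)
  \<comment> \<open>\<open>h\<close> and \<open>g\<close> cancel only on the carriers, so the two
    curves are compared on \<open>I\<close> alone and \<open>velocity_cong\<close> does the
    rest.\<close>
  have "(h \<circ> (g \<circ> d)) s = d s" if "s \<in> I" for s
    using d that assms h_in h_g by (auto simp: subset_iff)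
  then have "v = pushforward B h (velocity A (g \<circ> d) 0)"
    using velocity_cong[OF \<open>open I\<close> \<open>0 \<in> I\<close>, of "h \<circ> (g \<circ> d)" d B] d(1)
    by (simp add: velocity_compose)
  moreover have "(g \<circ> d) ` I \<subseteq> S"
  proof -
    have "g (d s) \<in> S" if "s \<in> I" for s
    proof -
      obtain x where "x \<in> S" "d s = h x" using d(4) \<open>s \<in> I\<close> by blast
      then show ?thesis using assms g_h by auto
    qed
    then show ?thesis by auto
  qed
  moreover have "(g \<circ> d) 0 = p"
    using d assms g_h by simp
  ultimately show "v \<in> pushforward B h ` tangent_space X A S p"
    using inv.smooth_curve_on_compose[OF d(3)] d(2) unfolding tangent_space_def by blast
next
  fix v assume "v \<in> pushforward B h ` tangent_space X A S p"
  then obtain c I where c: "v = pushforward B h (velocity A c 0)" "0 \<in> I"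
    "smooth_curve_on X A I c" "c ` I \<subseteq> S" "c 0 = p"
    by (auto simp: tangent_space_def)
  have "v = velocity B (h \<circ> c) 0 \<and> 0 \<in> I \<and> smooth_curve_on Y B I (h \<circ> c)
      \<and> (h \<circ> c) ` I \<subseteq> h ` S \<and> (h \<circ> c) 0 = h p"
    using c smooth_curve_on_compose by (auto simp: velocity_compose)
  then show "v \<in> tangent_space Y B (h ` S) (h p)"
    unfolding tangent_space_def by blast
qed

lemma h_image_topspace: "h ` topspace X = topspace Y"
  using h_in inv.h_in h_g by (force simp: image_iff)

text \<open>The pushforward is linear and maps the velocity and both tangent spaces to their
  counterparts, so applying it to the spanning equation in \<open>X\<close> yields the one in
  \<open>Y\<close>.\<close>

lemma semi_transversal_compose:
  assumes W: "W \<subseteq> topspace Y" and \<gamma>: "\<gamma> \<in> paths X"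
    and tr: "semi_transversal X A {x \<in> topspace X. h x \<in> W} \<gamma>"
  shows "semi_transversal Y B W (restrict (h \<circ> \<gamma>) {0..1})"
  unfolding semi_transversal_def
proof (intro ballI impI)
  define \<delta> where "\<delta> = restrict (h \<circ> \<gamma>) {0..1}"
  define Z where "Z = {x \<in> topspace X. h x \<in> W}"
  fix t :: real assume t: "t \<in> {0<..<1}" and "restrict (h \<circ> \<gamma>) {0..1} t \<in> W"
  then have \<delta>t: "\<delta> t = h (\<gamma> t)" and tX: "\<gamma> t \<in> topspace X" and tZ: "\<gamma> t \<in> Z"
    using path_in_topspace[OF \<gamma>] by (auto simp: \<delta>_def Z_def)
  have hZ: "h ` Z = W"
    using W h_g inv.h_in by (force simp: Z_def image_iff)
  obtain I where I: "t \<in> I" "smooth_curve_on X A I \<gamma>"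
    using tr t tZ by (auto simp: semi_transversal_def smooth_curve_at_def Z_def)
  \<comment> \<open>\<open>I\<close> may reach beyond the unit interval, where the restricted path
    is \<open>undefined\<close>; near an interior \<open>t\<close> the restriction is
    invisible.\<close>
  have "open (I \<inter> {0<..<1})"
    using I by (auto simp: smooth_curve_on_def)
  then have "smooth_curve_on Y B (I \<inter> {0<..<1}) (h \<circ> \<gamma>)"
    using I smooth_curve_on_subset smooth_curve_on_compose by blast
  then have "smooth_curve_on Y B (I \<inter> {0<..<1}) \<delta>"
    by (rule smooth_curve_on_cong) (auto simp: \<delta>_def)
  then have "smooth_curve_at Y B \<delta> t"
    using I t unfolding smooth_curve_at_def by blast
  moreover have "{\<lambda>f. a * velocity B \<delta> t f + w f |a w. w \<in> tangent_space Y B W (\<delta> t)}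
      = tangent_space Y B (topspace Y) (\<delta> t)"
  proof -
    let ?P = "pushforward B h"
    \<comment> \<open>Linearity holds on non-smooth arguments as well, because the default value
      there is \<open>0\<close>.\<close>
    have lin: "?P (\<lambda>f. a * v f + w f) = (\<lambda>f. a * ?P v f + ?P w f)" for a v w
      by (auto simp: pushforward_def)
    have "velocity B \<delta> t = velocity B (h \<circ> \<gamma>) t"
      by (rule velocity_cong[of "{0<..<1}"]) (use t in \<open>auto simp: \<delta>_def\<close>)
    then have "velocity B \<delta> t = ?P (velocity A \<gamma> t)"
      by (simp add: velocity_compose)
    moreover have "tangent_space Y B W (\<delta> t) = ?P ` tangent_space X A Z (\<gamma> t)"
      using tangent_space_image[of Z "\<gamma> t"] tX hZ \<delta>t by (auto simp: Z_def)
    ultimately have "{\<lambda>f. a * velocity B \<delta> t f + w f |a w. w \<in> tangent_space Y B W (\<delta> t)}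
        = {\<lambda>f. a * ?P (velocity A \<gamma> t) f + ?P w f |a w. w \<in> tangent_space X A Z (\<gamma> t)}"
      by (simp only:) blast
    also have "\<dots>
        = ?P ` {\<lambda>f. a * velocity A \<gamma> t f + w f |a w. w \<in> tangent_space X A Z (\<gamma> t)}"
      unfolding lin[symmetric] by blast
    also have "\<dots> = ?P ` tangent_space X A (topspace X) (\<gamma> t)"
      using tr t tZ by (auto simp: semi_transversal_def Z_def)
    also have "\<dots> = tangent_space Y B (topspace Y) (\<delta> t)"
      using tangent_space_image[of "topspace X" "\<gamma> t"] tX h_image_topspace \<delta>t by auto
    finally show ?thesis .
  qed
  ultimately show "smooth_curve_at Y B (restrict (h \<circ> \<gamma>) {0..1}) t \<and>
      {\<lambda>f. a * velocity B (restrict (h \<circ> \<gamma>) {0..1}) t f + w f |a w.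
        w \<in> tangent_space Y B W (restrict (h \<circ> \<gamma>) {0..1} t)}
      = tangent_space Y B (topspace Y) (restrict (h \<circ> \<gamma>) {0..1} t)"
    unfolding \<delta>_def by blast
qed

text \<open>The open sets are pulled back along \<open>g\<close> times \<open>g\<close>, and each
  section becomes: apply \<open>g\<close> to both endpoints, use the section in \<open>X\<close>,
  push the path forward by \<open>h\<close>. The number \<open>k\<close> is unchanged.\<close>

lemma has_transversal_cover_transport:
  assumes W: "W \<subseteq> topspace Y"
    and cov: "has_transversal_cover X A {x \<in> topspace X. h x \<in> W} k"
  shows "has_transversal_cover Y B W k"
proof -
  define Z where "Z = {x \<in> topspace X. h x \<in> W}"
  define G where "G = (\<lambda>q. (g (fst q), g (snd q)))"
  let ?XX = "prod_topology X X" and ?YY = "prod_topology Y Y"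
  have G: "continuous_map ?YY ?XX G"
    using continuous_map_compose[OF continuous_map_fst inv.h_continuous, of Y]
      continuous_map_compose[OF continuous_map_snd inv.h_continuous, of Y]
    by (simp add: G_def continuous_map_paired comp_def)
  obtain U where U: "\<forall>i\<in>{1..k}. openin ?XX (U i)"
    "(\<Union>i\<in>{1..k}. U i) = topspace X \<times> topspace X"
    "\<forall>i\<in>{1..k}. \<exists>s. continuous_map (subtopology ?XX (U i)) (path_space X) s \<and>
        (\<forall>q\<in>U i. endpoints (s q) = q \<and> semi_transversal X A Z (s q))"
    using cov unfolding has_transversal_cover_def Z_def[symmetric]
    by (elim exE conjE) (rule that)
  define V where "V i = {q \<in> topspace ?YY. G q \<in> U i}" for i
  have V_open: "openin ?YY (V i)" if "i \<in> {1..k}" for i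
    unfolding V_def using G U(1)[rule_format, OF that] by (rule openin_continuous_map_preimage)
  have V_cover: "(\<Union>i\<in>{1..k}. V i) = topspace Y \<times> topspace Y"
  proof -
    have "G q \<in> (\<Union>i\<in>{1..k}. U i)" if "q \<in> topspace ?YY" for q
      unfolding U(2) using that inv.h_in by (auto simp: G_def)
    then show ?thesis by (auto simp: V_def)
  qed
  have V_section: "\<exists>s. continuous_map (subtopology ?YY (V i)) (path_space Y) s \<and>
      (\<forall>q\<in>V i. endpoints (s q) = q \<and> semi_transversal Y B W (s q))" if i: "i \<in> {1..k}" for i
  proof -
    obtain s where s: "continuous_map (subtopology ?XX (U i)) (path_space X) s"
      "\<And>q. q \<in> U i \<Longrightarrow> endpoints (s q) = q \<and> semi_transversal X A Z (s q)"
      using U(3) i by blast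
    have GV: "continuous_map (subtopology ?YY (V i)) (subtopology ?XX (U i)) G"
      using G by (auto simp: continuous_map_in_subtopology V_def
          intro: continuous_map_from_subtopology)
    define s' where "s' = (\<lambda>\<gamma>. restrict (h \<circ> \<gamma>) {0..1}) \<circ> (s \<circ> G)"
    have "continuous_map (subtopology ?YY (V i)) (path_space Y) s'"
      unfolding s'_def
      using continuous_map_compose[OF continuous_map_compose[OF GV s(1)] path_space_compose] .
    moreover have "endpoints (s' q) = q \<and> semi_transversal Y B W (s' q)" if q: "q \<in> V i" for q
    proof -
      have qY: "fst q \<in> topspace Y" "snd q \<in> topspace Y" and Gq: "G q \<in> U i"
        using q by (auto simp: V_def)
      \<comment> \<open>Needed to know that \<open>s (G q)\<close> is a path: continuity of
        \<open>s\<close> controls values only on the carrier of its domain.\<close>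
      have "G q \<in> topspace (subtopology ?XX (U i))"
        using Gq U(1) i openin_subset by fastforce
      then have "s (G q) \<in> paths X"
        using s(1) by (auto simp: continuous_map_def topspace_path_space)
      then have "semi_transversal Y B W (s' q)"
        using semi_transversal_compose[OF W] s(2)[OF Gq] by (simp add: s'_def Z_def)
      moreover have "s (G q) 0 = g (fst q)" "s (G q) 1 = g (snd q)"
        using s(2)[OF Gq] by (auto simp: endpoints_def G_def)
      \<comment> \<open>The path in \<open>X\<close> joins the \<open>g\<close>-images of the two
        entries of \<open>q\<close>, and \<open>h\<close> undoes \<open>g\<close>; both parameters
        lie in \<open>{0..1}\<close>, so the restriction keeps the ends.\<close>
      then have "endpoints (s' q) = q"
        using h_g qY by (simp add: s'_def endpoints_def)
      ultimately show ?thesis by simp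
    qed
    ultimately show ?thesis by blast
  qed
  show ?thesis
    unfolding has_transversal_cover_def
    by (intro exI[of _ V] conjI ballI V_open V_cover V_section)
qed

end

theorem proposition2p15:
  fixes M :: "'a topology" and AM :: "('a, 'e::euclidean_space) chart set"
    and N :: "'b topology" and AN :: "('b, 'f::euclidean_space) chart set"
    and h :: "'a \<Rightarrow> 'b" and W :: "'b set"
  assumes "smooth_manifold M AM" and "path_connected_space M"
    and "smooth_manifold N AN" and "path_connected_space N"
    and "diffeomorphism M AM N AN h"
    and "submanifold N AN 1 W"
  shows "TTC N AN W = TTC M AM {x \<in> topspace M. h x \<in> W}"
proof -
  define g where "g = inv_into (topspace M) h"
  let ?Z = "{x \<in> topspace M. h x \<in> W}"
  have bij: "bij_betw h (topspace M) (topspace N)"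
    and sm: "smooth_map M AM N AN h" "smooth_map N AN M AM g"
    using assms(5) by (auto simp: diffeomorphism_def g_def)
  have gh: "g (h x) = x" if "x \<in> topspace M" for x
    using bij that unfolding g_def by (simp add: bij_betw_inv_into_left)
  have hg: "h (g y) = y" if "y \<in> topspace N" for y
    using bij that unfolding g_def by (simp add: bij_betw_inv_into_right)
  \<comment> \<open>The locale is symmetric in the two maps, so interpreting it twice with the roles
    exchanged gives transport of covers both ways.\<close>
  interpret MN: inverse_smooth_maps M AM N AN h g
    by unfold_locales (use assms sm gh hg in auto)
  interpret NM: inverse_smooth_maps N AN M AM g h
    by unfold_locales (use assms sm gh hg in auto)
  have W: "W \<subseteq> topspace N"
    using assms(6) by (simp add: submanifold_def)
  \<comment> \<open>Pulling \<open>?Z\<close> back along \<open>g\<close> returns \<open>W\<close>;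
    thus the reverse transport starts from covers for \<open>W\<close> itself, and both infima range
    over the same set of \<open>k\<close>.\<close>
  have "{y \<in> topspace N. g y \<in> ?Z} = W"
    using W hg MN.inv.h_in by auto
  then have "has_transversal_cover N AN W k \<longleftrightarrow> has_transversal_cover M AM ?Z k" for k
    using MN.has_transversal_cover_transport[OF W, of k]
      NM.has_transversal_cover_transport[of ?Z k] by auto
  then show ?thesis
    by (simp add: TTC_def)
qed

end
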